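(* Let $\|\cdot\|$ be a norm on $\mathbb{R}^d$ (the source norm), and let $\|\cdot\|^{\mathrm{tn}}_{(k)}$ be the associated generalized top-$k$ norms. - If $\|\cdot\|$ is orthant-monotonic, then the nondecreasing sequence $(\|\cdot\|^{\mathrm{tn}}_{(j)})_{j\in\{1,\dots,d\}}$ is increasingly graded with respect to the $\ell_0$ pseudonorm, that is, $$\ell_0(x)\le l \ \Longrightarrow\ \|x\|^{\mathrm{tn}}_{(l)}=\|x\|^{\mathrm{tn}}_{(d)}\qquad \forall x\in\mathbb{R}^d,\ \forall l\in\{0,1,\dots,d\}.$$ - If $\|\cdot\|$ is orthant-strictly monotonic, then the nondecreasing sequence $(\|\cdot\|^{\mathrm{tn}}_{(j)})_{j\in\{1,\dots,d\}}$ is strictly increasingly graded with respect to the $\ell_0$ pseudonorm, that is, $$\ell_0(x)\le l \iff \|x\|^{\mathrm{tn}}_{(l)}=\|x\|^{\mathrm{tn}}_{(d)}\qquad \forall x\in\mathbb{R}^d,\ \forall l\in\{0,1,\dots,d\}.$$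
   Context: $d\ge 1$ is an integer. $\ell_0(x)$ is the number of nonzero components of $x\in\mathbb{R}^d$. For $K\subset\{1,\dots,d\}$, $x_K$ is the vector that coincides with $x$ on $K$ and is zero outside $K$. The generalized top-$k$ norm is $\|x\|^{\mathrm{tn}}_{(k)}=\sup\{\|x_K\| : K\subset\{1,\dots,d\},\ |K|\le k\}$ for $k\in\{1,\dots,d\}$; for $k=0$ the same formula gives $\|x\|^{\mathrm{tn}}_{(0)}=0$. A norm $\|\cdot\|$ is orthant-monotonic if, for all $x,x'\in\mathbb{R}^d$, ($|x_i|\le|x_i'|$ and $x_ix_i'\ge 0$ for all $i$) implies $\|x\|\le\|x'\|$. It is orthant-strictly monotonic if, for all $x,x'\in\mathbb{R}^d$, ($|x_i|\le|x_i'|$ and $x_ix_i'\ge 0$ for all $i$, and $|x_j|<|x'_j|$ for some $j$) implies $\|x\|<\|x'\|$. A sequence of norms $(N_k)_{k\in\{1,\dots,d\}}$ on $\mathbb{R}^d$ is increasingly graded (resp. strictly increasingly graded) with respect to $\ell_0$ if, for any $x\in\mathbb{R}^d$, the sequence $k\mapsto N_k(x)$ is nondecreasing and, for any $l\in\{1,\dots,d\}$, $\ell_0(x)\le l$ implies (resp. is equivalent to) $N_l(x)=N_d(x)$. *)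

theory Defs
  imports "HOL-Analysis.Analysis"
begin

text \<open>The space of dimension \<open>d \<ge> 1\<close> is \<^typ>\<open>real ^ 'n\<close> with \<open>d = CARD('n)\<close>; the index set
  \<open>{1..d}\<close> is the type \<^typ>\<open>'n\<close>. Norms are arbitrary functions satisfying the norm axioms, unrelated
  to the Euclidean \<^const>\<open>norm\<close> of the type class.\<close>

definition is_norm :: "('a::real_vector \<Rightarrow> real) \<Rightarrow> bool" where
  "is_norm N \<longleftrightarrow>
     (\<forall>x. 0 \<le> N x) \<and>
     (\<forall>x. N x = 0 \<longleftrightarrow> x = 0) \<and>
     (\<forall>c x. N (c *\<^sub>R x) = \<bar>c\<bar> * N x) \<and>
     (\<forall>x y. N (x + y) \<le> N x + N y)"

definition ell0 :: "real ^ 'n \<Rightarrow> nat" where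
  "ell0 x = card {i. x $ i \<noteq> 0}"

definition vec_restrict :: "real ^ 'n \<Rightarrow> 'n set \<Rightarrow> real ^ 'n" where
  "vec_restrict x K = (\<chi> i. if i \<in> K then x $ i else 0)"

text \<open>The supremum is over a finite nonempty set of reals, for every \<open>k\<close>; for \<open>k = 0\<close> only the empty
  set contributes.\<close>

definition top_norm :: "(real ^ 'n \<Rightarrow> real) \<Rightarrow> nat \<Rightarrow> real ^ 'n \<Rightarrow> real" where
  "top_norm N k x = (SUP K\<in>{K. card K \<le> k}. N (vec_restrict x K))"

definition orthant_monotonic :: "(real ^ 'n \<Rightarrow> real) \<Rightarrow> bool" where
  "orthant_monotonic N \<longleftrightarrow>
     (\<forall>x x'. (\<forall>i. \<bar>x $ i\<bar> \<le> \<bar>x' $ i\<bar> \<and> x $ i * x' $ i \<ge> 0) \<longrightarrow> N x \<le> N x')"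

definition orthant_strictly_monotonic :: "(real ^ 'n \<Rightarrow> real) \<Rightarrow> bool" where
  "orthant_strictly_monotonic N \<longleftrightarrow>
     (\<forall>x x'. (\<forall>i. \<bar>x $ i\<bar> \<le> \<bar>x' $ i\<bar> \<and> x $ i * x' $ i \<ge> 0) \<and> (\<exists>j. \<bar>x $ j\<bar> < \<bar>x' $ j\<bar>)
        \<longrightarrow> N x < N x')"

text \<open>A sequence \<open>N\<close> is indexed by \<open>{1..d}\<close>; the values of \<open>N k\<close> for other \<open>k\<close> are irrelevant in the
  two notions below.\<close>

definition increasingly_graded :: "(nat \<Rightarrow> real ^ 'n \<Rightarrow> real) \<Rightarrow> bool" where
  "increasingly_graded N \<longleftrightarrow>
     (\<forall>k\<in>{1..CARD('n)}. is_norm (N k)) \<and>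
     (\<forall>x. mono_on {1..CARD('n)} (\<lambda>k. N k x)) \<and>
     (\<forall>x. \<forall>l\<in>{1..CARD('n)}. ell0 x \<le> l \<longrightarrow> N l x = N (CARD('n)) x)"

definition strictly_increasingly_graded :: "(nat \<Rightarrow> real ^ 'n \<Rightarrow> real) \<Rightarrow> bool" where
  "strictly_increasingly_graded N \<longleftrightarrow>
     (\<forall>k\<in>{1..CARD('n)}. is_norm (N k)) \<and>
     (\<forall>x. mono_on {1..CARD('n)} (\<lambda>k. N k x)) \<and>
     (\<forall>x. \<forall>l\<in>{1..CARD('n)}. ell0 x \<le> l \<longleftrightarrow> N l x = N (CARD('n)) x)"

end

theory Submission
  imports Defs
begin

text \<open>The supremum defining a generalized top-\<open>k\<close> norm runs over finitely many coordinate sets, so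
  it is attained; this gives the norm axioms for \<open>k \<ge> 1\<close> and the growth in \<open>k\<close>.
  Orthant-monotonicity says in particular that erasing coordinates does not increase the
  norm. Hence no \<open>top_norm N l x\<close> exceeds \<open>N x\<close>, and \<open>N x\<close> is reached as soon as the support of
  \<open>x\<close>, which has \<open>ell0 x\<close> elements, is an admissible coordinate set: this happens for
  every \<open>l \<ge> ell0 x\<close>, and in particular for \<open>l = CARD('n)\<close>. If the monotonicity
  is strict and \<open>l < ell0 x\<close>, every admissible set misses a nonzero coordinate of \<open>x\<close>, so
  each competitor is strictly below \<open>N x\<close>; the supremum being attained, it is strictly
  below \<open>N x\<close> too (lemmas \<open>top_norm_eq_norm\<close> and \<open>top_norm_less_norm\<close>).\<close>

lemma vec_restrict_nth [simp]: "vec_restrict x K $ i = (if i \<in> K then x $ i else 0)"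
  by (simp add: vec_restrict_def)

lemma vec_restrict_add: "vec_restrict (x + y) K = vec_restrict x K + vec_restrict y K"
  by (simp add: vec_eq_iff)

lemma vec_restrict_scaleR: "vec_restrict (c *\<^sub>R x) K = c *\<^sub>R vec_restrict x K"
  by (simp add: vec_eq_iff)

lemma norm_vec_restrict_le_top_norm:
  fixes N :: "real ^ 'n \<Rightarrow> real"
  assumes "card K \<le> k"
  shows "N (vec_restrict x K) \<le> top_norm N k x"
  unfolding top_norm_def using assms by (intro cSUP_upper bdd_above_finite) auto

lemma top_norm_attained:
  fixes N :: "real ^ 'n \<Rightarrow> real"
  obtains K where "card K \<le> k" "top_norm N k x = N (vec_restrict x K)"
proof -
  let ?S = "(\<lambda>K. N (vec_restrict x K)) ` {K. card K \<le> k}"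
  have "card ({} :: 'n set) \<le> k"
    by simp
  then have "?S \<noteq> {}"
    by blast
  then have "Sup ?S \<in> ?S"
    using Max_in[of ?S] by (simp add: cSup_eq_Max)
  then show thesis
    using that unfolding top_norm_def by blast
qed

text \<open>Definiteness is where \<open>k \<ge> 1\<close> enters: the singletons are then admissible, and together they
  detect every coordinate.\<close>

lemma is_norm_top_norm:
  fixes N :: "real ^ 'n \<Rightarrow> real"
  assumes N: "is_norm N" and k: "1 \<le> k"
  shows "is_norm (top_norm N k)"
proof -
  have nonneg: "0 \<le> N x" and zero: "N x = 0 \<longleftrightarrow> x = 0"
    and scale: "N (c *\<^sub>R x) = \<bar>c\<bar> * N x" and triangle: "N (x + y) \<le> N x + N y" for c x y
    using N by (auto simp: is_norm_def)
  have top_nonneg: "0 \<le> top_norm N k x" for x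
    using top_norm_attained[of k N x] nonneg by metis
  have top_zero: "top_norm N k x = 0 \<longleftrightarrow> x = 0" for x
  proof
    assume top: "top_norm N k x = 0"
    have "x $ i = 0" for i
    proof -
      have "N (vec_restrict x {i}) \<le> 0"
        using norm_vec_restrict_le_top_norm[of "{i}" k N x] k top by simp
      then have "vec_restrict x {i} = 0"
        using nonneg[of "vec_restrict x {i}"] zero by auto
      then show ?thesis
        by (auto simp: vec_eq_iff split: if_splits)
    qed
    then show "x = 0"
      by (simp add: vec_eq_iff)
  next
    assume "x = 0"
    then have "vec_restrict x K = 0" for K
      by (simp add: vec_eq_iff)
    then show "top_norm N k x = 0"
      using top_norm_attained[of k N x] zero by metis
  qed
  have top_scale: "top_norm N k (c *\<^sub>R x) = \<bar>c\<bar> * top_norm N k x" for c x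
  proof (rule antisym)
    obtain K where "card K \<le> k" "top_norm N k (c *\<^sub>R x) = N (vec_restrict (c *\<^sub>R x) K)"
      by (rule top_norm_attained)
    then show "top_norm N k (c *\<^sub>R x) \<le> \<bar>c\<bar> * top_norm N k x"
      by (simp add: vec_restrict_scaleR scale mult_left_mono norm_vec_restrict_le_top_norm)
  next
    obtain K where "card K \<le> k" "top_norm N k x = N (vec_restrict x K)"
      by (rule top_norm_attained)
    then show "\<bar>c\<bar> * top_norm N k x \<le> top_norm N k (c *\<^sub>R x)"
      using norm_vec_restrict_le_top_norm[of K k N "c *\<^sub>R x"] by (simp add: vec_restrict_scaleR scale)
  qed
  have top_triangle: "top_norm N k (x + y) \<le> top_norm N k x + top_norm N k y" for x y
  proof -
    obtain K where K: "card K \<le> k" "top_norm N k (x + y) = N (vec_restrict (x + y) K)"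
      by (rule top_norm_attained)
    have "N (vec_restrict (x + y) K) \<le> N (vec_restrict x K) + N (vec_restrict y K)"
      by (simp add: vec_restrict_add triangle)
    also have "\<dots> \<le> top_norm N k x + top_norm N k y"
      using K(1) by (intro add_mono norm_vec_restrict_le_top_norm)
    finally show ?thesis
      using K(2) by simp
  qed
  show ?thesis
    using top_nonneg top_zero top_scale top_triangle by (simp add: is_norm_def)
qed

lemma top_norm_mono:
  fixes N :: "real ^ 'n \<Rightarrow> real"
  assumes "k \<le> l"
  shows "top_norm N k x \<le> top_norm N l x"
proof -
  obtain K where "card K \<le> k" "top_norm N k x = N (vec_restrict x K)"
    by (rule top_norm_attained)
  then show ?thesis
    using norm_vec_restrict_le_top_norm[of K l N x] assms by simp
qed

text \<open>Strict monotonicity only speaks of pairs with a strict coordinate; for the remaining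
  pairs, equal absolute values and agreeing signs force the two vectors to coincide.\<close>

lemma orthant_strictly_monotonic_imp_orthant_monotonic:
  fixes N :: "real ^ 'n \<Rightarrow> real"
  assumes "orthant_strictly_monotonic N"
  shows "orthant_monotonic N"
  unfolding orthant_monotonic_def
proof (intro allI impI)
  fix x x' :: "real ^ 'n"
  assume le: "\<forall>i. \<bar>x $ i\<bar> \<le> \<bar>x' $ i\<bar> \<and> x $ i * x' $ i \<ge> 0"
  show "N x \<le> N x'"
  proof (cases "\<exists>j. \<bar>x $ j\<bar> < \<bar>x' $ j\<bar>")
    case True
    then show ?thesis
      using assms le unfolding orthant_strictly_monotonic_def by (blast intro: less_imp_le)
  next
    case False
    have "x $ i = x' $ i" for i
    proof -
      have "\<bar>x $ i\<bar> = \<bar>x' $ i\<bar>"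
        using False le by (meson antisym not_less)
      moreover have "0 \<le> x $ i * x' $ i"
        using le by blast
      ultimately show ?thesis
        by (auto simp: abs_eq_iff mult_le_0_iff)
    qed
    then have "x = x'"
      by (simp add: vec_eq_iff)
    then show ?thesis
      by simp
  qed
qed

lemma ell0_le_card: "ell0 (x :: real ^ 'n) \<le> CARD('n)"
  unfolding ell0_def by (intro card_mono) auto

lemma top_norm_eq_norm:
  fixes N :: "real ^ 'n \<Rightarrow> real"
  assumes mono: "orthant_monotonic N" and l: "ell0 x \<le> l"
  shows "top_norm N l x = N x"
proof (rule antisym)
  obtain K where "top_norm N l x = N (vec_restrict x K)"
    by (rule top_norm_attained)
  moreover have "N (vec_restrict x K) \<le> N x"
    using mono unfolding orthant_monotonic_def by simp
  ultimately show "top_norm N l x \<le> N x"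
    by simp
next
  have "vec_restrict x {i. x $ i \<noteq> 0} = x"
    by (simp add: vec_eq_iff)
  then show "N x \<le> top_norm N l x"
    using norm_vec_restrict_le_top_norm[of "{i. x $ i \<noteq> 0}" l N x] l by (simp add: ell0_def)
qed

lemma top_norm_less_norm:
  fixes N :: "real ^ 'n \<Rightarrow> real"
  assumes mono: "orthant_strictly_monotonic N" and l: "l < ell0 x"
  shows "top_norm N l x < N x"
proof -
  obtain K where K: "card K \<le> l" "top_norm N l x = N (vec_restrict x K)"
    by (rule top_norm_attained)
  have "\<not> {i. x $ i \<noteq> 0} \<subseteq> K"
  proof
    assume "{i. x $ i \<noteq> 0} \<subseteq> K"
    then have "ell0 x \<le> card K"
      unfolding ell0_def by (intro card_mono) auto
    then show False
      using K(1) l by simp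
  qed
  then obtain j where "x $ j \<noteq> 0" "j \<notin> K"
    by blast
  then have "\<bar>vec_restrict x K $ j\<bar> < \<bar>x $ j\<bar>"
    by simp
  moreover have "\<forall>i. \<bar>vec_restrict x K $ i\<bar> \<le> \<bar>x $ i\<bar> \<and> vec_restrict x K $ i * x $ i \<ge> 0"
    by simp
  ultimately have "N (vec_restrict x K) < N x"
    using mono unfolding orthant_strictly_monotonic_def by blast
  then show ?thesis
    using K(2) by simp
qed

theorem proposition18:
  fixes N :: "real ^ 'n \<Rightarrow> real"
  assumes "is_norm N"
  shows "(orthant_monotonic N \<longrightarrow>
            increasingly_graded (top_norm N) \<and>
            (\<forall>x. \<forall>l\<in>{0..CARD('n)}.
               ell0 x \<le> l \<longrightarrow> top_norm N l x = top_norm N (CARD('n)) x)) \<and>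
         (orthant_strictly_monotonic N \<longrightarrow>
            strictly_increasingly_graded (top_norm N) \<and>
            (\<forall>x. \<forall>l\<in>{0..CARD('n)}.
               ell0 x \<le> l \<longleftrightarrow> top_norm N l x = top_norm N (CARD('n)) x))"
proof -
  have norms: "\<forall>k\<in>{1..CARD('n)}. is_norm (top_norm N k)"
    using is_norm_top_norm[OF assms] by simp
  have incr: "\<forall>x. mono_on {1..CARD('n)} (\<lambda>k. top_norm N k x)"
    by (simp add: mono_onI top_norm_mono)
  have graded: "top_norm N l x = top_norm N (CARD('n)) x"
    if "orthant_monotonic N" "ell0 x \<le> l" for l x
    using that top_norm_eq_norm ell0_le_card by metis
  have strictly_graded: "ell0 x \<le> l \<longleftrightarrow> top_norm N l x = top_norm N (CARD('n)) x"
    if strict: "orthant_strictly_monotonic N" for l x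
  proof
    assume "ell0 x \<le> l"
    then show "top_norm N l x = top_norm N (CARD('n)) x"
      using graded orthant_strictly_monotonic_imp_orthant_monotonic[OF strict] by blast
  next
    assume "top_norm N l x = top_norm N (CARD('n)) x"
    also have "\<dots> = N x"
      using top_norm_eq_norm orthant_strictly_monotonic_imp_orthant_monotonic[OF strict]
        ell0_le_card by blast
    finally show "ell0 x \<le> l"
      using top_norm_less_norm[OF strict, of l x] by (cases "ell0 x \<le> l") simp_all
  qed
  show ?thesis
    unfolding increasingly_graded_def strictly_increasingly_graded_def
    using norms incr graded strictly_graded by blast
qed

end
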